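(* Let a twist hierarchy of length $n$ be given, with groups $G_1,\dots,G_n=G$ and $H_1,\dots,H_n$, homomorphisms $\rho_{i-1}:G_{i-1}\to\mathrm{Aut}(H_i)$ ($2\le i\le n$) and twists $J_i$ for $\mathbb{C}[H_i]$ ($1\le i\le n$). Let $A=H_1\times\cdots\times H_n$, let $\pi:G\to A$ be the bijection $\pi(x_n\cdots x_1)=(x_1,\dots,x_n)$, $x_i\in H_i$, let $J=J_1\otimes\cdots\otimes J_n\in\mathbb{C}[A]\otimes\mathbb{C}[A]$, and let $\bar J=(\pi^{-1}\otimes\pi^{-1})(J)\in\mathbb{C}[G]\otimes\mathbb{C}[G]$. Then $\bar J=J_n\cdots J_1$, and $\bar J$ is a twist for $\mathbb{C}[G]$.
   Context: A twist for a Hopf algebra $\mathcal A$ (coproduct $\Delta$, counit $\varepsilon$, identity map $I$) is an invertible $J\in\mathcal A\otimes\mathcal A$ with $(\Delta\otimes I)(J)J_{12}=(I\otimes\Delta)(J)J_{23}$ and $(\varepsilon\otimes I)(J)=(I\otimes\varepsilon)(J)=1$. A hierarchy of length $n$ consists of finite groups $G_1,\dots,G_n=G$, $H_1,\dots,H_n$ and homomorphisms $\rho_{i-1}:G_{i-1}\to\mathrm{Aut}(H_i)$, $i=2,\dots,n$, such that $G_1=H_1$ and $G_i=G_{i-1}\ltimes H_i$ (semidirect product made using $\rho_{i-1}$, so $ghg^{-1}=\rho_{i-1}(g)(h)$ for $g\in G_{i-1}$, $h\in H_i$). All $G_i$ and $H_i$ are canonically subgroups of $G$, and each element of $G$ is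 uniquely of the form $x_n\cdots x_1$ with $x_i\in H_i$. A twist hierarchy is a hierarchy together with twists $J_i$ for $\mathbb{C}[H_i]$, $i=1,\dots,n$, such that $J_i$ is invariant under $\rho_{i-1}(G_{i-1})$ (acting diagonally on $\mathbb{C}[H_i]\otimes\mathbb{C}[H_i]$) for $i=2,\dots,n$. $J_1\otimes\cdots\otimes J_n$ is regarded as an element of $\mathbb{C}[A]\otimes\mathbb{C}[A]$ via $\mathbb{C}[A]\otimes\mathbb{C}[A]\cong\bigotimes_i(\mathbb{C}[H_i]\otimes\mathbb{C}[H_i])$. The map $\pi^{-1}$ is extended linearly to $\mathbb{C}[A]\to\mathbb{C}[G]$. The product $J_n\cdots J_1$ is taken in $\mathbb{C}[G]\otimes\mathbb{C}[G]$, using $H_i\subset G$. *)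

theory Defs
  imports Complex_Main "HOL-Algebra.Ring" "HOL-Algebra.Bij" "HOL-Algebra.Product_Groups"
begin

section \<open>Group algebras and twists\<close>

text \<open>
  For a finite group \<open>G\<close>, an element of \<open>\<complex>[G]\<close> is its coefficient function, extended by zero
  outside the carrier. Tensor powers are read through
  \<open>\<complex>[G] \<otimes> \<complex>[K] = \<complex>[G \<times> K]\<close>, where \<open>g \<otimes> k\<close> is the basis vector \<open>(g, k)\<close>; thus
  \<open>\<complex>[G] \<otimes> \<complex>[G]\<close> is \<open>group_algebra (G \<times>\<times> G)\<close>, with its componentwise product.
\<close>

definition group_algebra :: "('g, 'm) monoid_scheme \<Rightarrow> ('g \<Rightarrow> complex) ring" where
  "group_algebra G =
    \<lparr>carrier = {u. \<forall>g. g \<notin> carrier G \<longrightarrow> u g = 0},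
     mult = (\<lambda>u v g. \<Sum>(a, b) \<in> {(a, b) \<in> carrier G \<times> carrier G. a \<otimes>\<^bsub>G\<^esub> b = g}. u a * v b),
     one = (\<lambda>g. if g = \<one>\<^bsub>G\<^esub> then 1 else 0),
     zero = (\<lambda>g. 0),
     add = (\<lambda>u v g. u g + v g)\<rparr>"

text \<open>The linear map \<open>\<complex>[X] \<rightarrow> \<complex>[Y]\<close> extending a map \<open>f : X \<rightarrow> Y\<close> of basis elements (\<open>X\<close> finite).\<close>

definition lin_ext :: "'x set \<Rightarrow> ('x \<Rightarrow> 'y) \<Rightarrow> ('x \<Rightarrow> complex) \<Rightarrow> 'y \<Rightarrow> complex" where
  "lin_ext X f u = (\<lambda>y. \<Sum>x \<in> {x \<in> X. f x = y}. u x)"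

definition coproduct :: "('g, 'm) monoid_scheme \<Rightarrow> ('g \<Rightarrow> complex) \<Rightarrow> 'g \<times> 'g \<Rightarrow> complex" where
  "coproduct G = lin_ext (carrier G) (\<lambda>g. (g, g))"

definition counit :: "('g, 'm) monoid_scheme \<Rightarrow> ('g \<Rightarrow> complex) \<Rightarrow> complex" where
  "counit G u = (\<Sum>g \<in> carrier G. u g)"

text \<open>
  A linear map is applied to one tensor factor by fixing the coordinate of the other one:
  if \<open>J = u \<otimes> v\<close>, then \<open>\<lambda>x. J (x, c)\<close> is \<open>v c\<close> times \<open>u\<close>, so that
  \<open>coproduct G (\<lambda>x. J (x, c)) (a, b)\<close> is the coefficient of \<open>\<Delta> u \<otimes> v\<close> at \<open>(a, b, c)\<close>.
  In this way both \<open>\<Delta> \<otimes> I\<close> and \<open>I \<otimes> \<Delta>\<close> take values in \<open>\<complex>[G \<times> G \<times> G]\<close>, and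
  \<open>\<epsilon> \<otimes> I\<close> and \<open>I \<otimes> \<epsilon>\<close> take values in \<open>\<complex>[G]\<close>.
\<close>

definition coproduct_id ::
  "('g, 'm) monoid_scheme \<Rightarrow> ('g \<times> 'g \<Rightarrow> complex) \<Rightarrow> 'g \<times> 'g \<times> 'g \<Rightarrow> complex" where
  "coproduct_id G J = (\<lambda>(a, b, c). coproduct G (\<lambda>x. J (x, c)) (a, b))"

definition id_coproduct ::
  "('g, 'm) monoid_scheme \<Rightarrow> ('g \<times> 'g \<Rightarrow> complex) \<Rightarrow> 'g \<times> 'g \<times> 'g \<Rightarrow> complex" where
  "id_coproduct G J = (\<lambda>(a, b, c). coproduct G (\<lambda>x. J (a, x)) (b, c))"

definition counit_id ::
  "('g, 'm) monoid_scheme \<Rightarrow> ('g \<times> 'g \<Rightarrow> complex) \<Rightarrow> 'g \<Rightarrow> complex" where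
  "counit_id G J = (\<lambda>b. counit G (\<lambda>x. J (x, b)))"

definition id_counit ::
  "('g, 'm) monoid_scheme \<Rightarrow> ('g \<times> 'g \<Rightarrow> complex) \<Rightarrow> 'g \<Rightarrow> complex" where
  "id_counit G J = (\<lambda>a. counit G (\<lambda>x. J (a, x)))"

definition leg12 ::
  "('g, 'm) monoid_scheme \<Rightarrow> ('g \<times> 'g \<Rightarrow> complex) \<Rightarrow> 'g \<times> 'g \<times> 'g \<Rightarrow> complex" where
  "leg12 G J = (\<lambda>(a, b, c). J (a, b) * \<one>\<^bsub>group_algebra G\<^esub> c)"

definition leg23 ::
  "('g, 'm) monoid_scheme \<Rightarrow> ('g \<times> 'g \<Rightarrow> complex) \<Rightarrow> 'g \<times> 'g \<times> 'g \<Rightarrow> complex" where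
  "leg23 G J = (\<lambda>(a, b, c). \<one>\<^bsub>group_algebra G\<^esub> a * J (b, c))"

definition is_twist :: "('g, 'm) monoid_scheme \<Rightarrow> ('g \<times> 'g \<Rightarrow> complex) \<Rightarrow> bool" where
  "is_twist G J \<longleftrightarrow>
     J \<in> Units (group_algebra (G \<times>\<times> G)) \<and>
     coproduct_id G J \<otimes>\<^bsub>group_algebra (G \<times>\<times> G \<times>\<times> G)\<^esub> leg12 G J =
       id_coproduct G J \<otimes>\<^bsub>group_algebra (G \<times>\<times> G \<times>\<times> G)\<^esub> leg23 G J \<and>
     counit_id G J = \<one>\<^bsub>group_algebra G\<^esub> \<and>
     id_counit G J = \<one>\<^bsub>group_algebra G\<^esub>"


section \<open>Hierarchies\<close>

text \<open>
  The pair \<open>(g, h)\<close> stands for the product \<open>h g\<close>, where \<open>g \<in> K\<close> is identified with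
  \<open>(g, 1)\<close> and \<open>h \<in> N\<close> with \<open>(1, h)\<close>; hence \<open>g h g\<^sup>-\<^sup>1 = \<rho> g h\<close>.
\<close>

definition semidirect_product ::
  "('k, 'm) monoid_scheme \<Rightarrow> ('h, 'p) monoid_scheme \<Rightarrow> ('k \<Rightarrow> 'h \<Rightarrow> 'h) \<Rightarrow> ('k \<times> 'h) monoid" where
  "semidirect_product K N \<rho> =
    \<lparr>carrier = carrier K \<times> carrier N,
     mult = (\<lambda>(g, h) (g', h'). (g \<otimes>\<^bsub>K\<^esub> g', h \<otimes>\<^bsub>N\<^esub> \<rho> g h')),
     one = (\<one>\<^bsub>K\<^esub>, \<one>\<^bsub>N\<^esub>)\<rparr>"

text \<open>
  All groups have to live in one type, whereas the type of pairs grows with each semidirect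
  product. Therefore \<open>G\<^sub>i = G\<^sub>i\<^sub>-\<^sub>1 \<ltimes> H\<^sub>i\<close> is expressed by an identification \<open>\<phi> i\<close>, which may be
  any isomorphism from the external semidirect product to \<open>G\<^sub>i\<close>.
  Only the indices \<open>1, \<dots>, n\<close> of \<open>G\<close> and \<open>H\<close>, \<open>1, \<dots>, n - 1\<close> of \<open>\<rho>\<close> and
  \<open>2, \<dots>, n\<close> of \<open>\<phi>\<close> are relevant.
\<close>

locale hierarchy =
  fixes n :: nat
    and G H :: "nat \<Rightarrow> 'g monoid"
    and \<rho> :: "nat \<Rightarrow> 'g \<Rightarrow> 'g \<Rightarrow> 'g"
    and \<phi> :: "nat \<Rightarrow> 'g \<times> 'g \<Rightarrow> 'g"
  assumes length_pos: "1 \<le> n"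
    and group_G: "\<And>i. i \<in> {1..n} \<Longrightarrow> group (G i)"
    and finite_G: "\<And>i. i \<in> {1..n} \<Longrightarrow> finite (carrier (G i))"
    and group_H: "\<And>i. i \<in> {1..n} \<Longrightarrow> group (H i)"
    and finite_H: "\<And>i. i \<in> {1..n} \<Longrightarrow> finite (carrier (H i))"
    and G_1: "G 1 = H 1"
    and \<rho>_hom: "\<And>i. i \<in> {2..n} \<Longrightarrow> \<rho> (i - 1) \<in> hom (G (i - 1)) (AutoGroup (H i))"
    and \<phi>_iso: "\<And>i. i \<in> {2..n} \<Longrightarrow>
      \<phi> i \<in> iso (semidirect_product (G (i - 1)) (H i) (\<rho> (i - 1))) (G i)"

text \<open>\<open>emb_G G H \<phi> i k : G\<^sub>i \<rightarrow> G\<^sub>i\<^sub>+\<^sub>k\<close> and \<open>emb_H G H \<phi> n i : H\<^sub>i \<rightarrow> G\<^sub>n\<close> are the canonical embeddings.\<close>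

primrec emb_G ::
  "(nat \<Rightarrow> 'g monoid) \<Rightarrow> (nat \<Rightarrow> 'g monoid) \<Rightarrow> (nat \<Rightarrow> 'g \<times> 'g \<Rightarrow> 'g) \<Rightarrow> nat \<Rightarrow> nat \<Rightarrow> 'g \<Rightarrow> 'g" where
  "emb_G G H \<phi> i 0 = (\<lambda>g. g)"
| "emb_G G H \<phi> i (Suc k) = (\<lambda>g. \<phi> (Suc (i + k)) (emb_G G H \<phi> i k g, \<one>\<^bsub>H (Suc (i + k))\<^esub>))"

definition emb_H ::
  "(nat \<Rightarrow> 'g monoid) \<Rightarrow> (nat \<Rightarrow> 'g monoid) \<Rightarrow> (nat \<Rightarrow> 'g \<times> 'g \<Rightarrow> 'g) \<Rightarrow> nat \<Rightarrow> nat \<Rightarrow> 'g \<Rightarrow> 'g" where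
  "emb_H G H \<phi> n i h =
     emb_G G H \<phi> i (n - i) (if i = 1 then h else \<phi> i (\<one>\<^bsub>G (i - 1)\<^esub>, h))"

text \<open>\<open>desc_prod M x n\<close> is \<open>x\<^sub>n \<cdots> x\<^sub>1\<close> computed in \<open>M\<close>.\<close>

primrec desc_prod :: "('a, 'm) monoid_scheme \<Rightarrow> (nat \<Rightarrow> 'a) \<Rightarrow> nat \<Rightarrow> 'a" where
  "desc_prod M x 0 = \<one>\<^bsub>M\<^esub>"
| "desc_prod M x (Suc k) = x (Suc k) \<otimes>\<^bsub>M\<^esub> desc_prod M x k"

text \<open>The bijection \<open>\<pi>\<close>, from \<open>G\<^sub>n\<close> to the direct product \<open>product_group {1..n} H\<close>.\<close>

definition hierarchy_pi ::
  "nat \<Rightarrow> (nat \<Rightarrow> 'g monoid) \<Rightarrow> (nat \<Rightarrow> 'g monoid) \<Rightarrow> (nat \<Rightarrow> 'g \<times> 'g \<Rightarrow> 'g) \<Rightarrow> 'g \<Rightarrow> nat \<Rightarrow> 'g" where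
  "hierarchy_pi n G H \<phi> g =
     (THE x. x \<in> carrier (product_group {1..n} H) \<and>
             desc_prod (G n) (\<lambda>i. emb_H G H \<phi> n i (x i)) n = g)"

locale twist_hierarchy = hierarchy n G H \<rho> \<phi>
  for n :: nat
    and G H :: "nat \<Rightarrow> 'g monoid"
    and \<rho> :: "nat \<Rightarrow> 'g \<Rightarrow> 'g \<Rightarrow> 'g"
    and \<phi> :: "nat \<Rightarrow> 'g \<times> 'g \<Rightarrow> 'g" +
  fixes J :: "nat \<Rightarrow> 'g \<times> 'g \<Rightarrow> complex"
  assumes twist_J: "\<And>i. i \<in> {1..n} \<Longrightarrow> is_twist (H i) (J i)"
    and invariant_J: "\<And>i g. \<lbrakk>i \<in> {2..n}; g \<in> carrier (G (i - 1))\<rbrakk> \<Longrightarrow>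
      lin_ext (carrier (H i) \<times> carrier (H i)) (map_prod (\<rho> (i - 1) g) (\<rho> (i - 1) g)) (J i) = J i"

text \<open>\<open>J\<^sub>1 \<otimes> \<cdots> \<otimes> J\<^sub>n\<close> as an element of \<open>\<complex>[A] \<otimes> \<complex>[A]\<close> with \<open>A = H\<^sub>1 \<times> \<cdots> \<times> H\<^sub>n\<close>.\<close>

definition tensor_family ::
  "nat \<Rightarrow> (nat \<Rightarrow> 'g monoid) \<Rightarrow> (nat \<Rightarrow> 'g \<times> 'g \<Rightarrow> complex) \<Rightarrow> (nat \<Rightarrow> 'g) \<times> (nat \<Rightarrow> 'g) \<Rightarrow> complex" where
  "tensor_family n H J = (\<lambda>(x, y).
     if x \<in> carrier (product_group {1..n} H) \<and> y \<in> carrier (product_group {1..n} H)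
     then \<Prod>i = 1..n. J i (x i, y i) else 0)"

end

theory Submission
  imports Defs
begin

text \<open>
  Write \<open>L\<^sub>i\<close> for the image of \<open>J\<^sub>i\<close> in \<open>\<complex>[G] \<otimes> \<complex>[G]\<close> under the embedding \<open>H\<^sub>i \<subseteq> G\<close>.

  The formula \<open>J\<^sub>n \<cdots> J\<^sub>1\<close> for the pulled back tensor is bilinear bookkeeping: \<open>\<pi>\<^sup>-\<^sup>1\<close> is the
  map \<open>(x\<^sub>1, \<dots>, x\<^sub>n) \<mapsto> x\<^sub>n \<cdots> x\<^sub>1\<close>, and a descending product of pushforwards is the pushforward
  of the tensor along the descending product (\<open>desc_prod_lin_ext\<close>). That \<open>\<pi>\<^sup>-\<^sup>1\<close> is this map is unique
  factorisation in \<open>G\<close> (\<open>bij_betw_desc_prod\<close>).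

  For the twist property, the point is that the coproduct \<open>\<Delta> \<otimes> I\<close>, the leg \<open>J \<mapsto> J\<^sub>1\<^sub>2\<close>, their
  mirror images, and the counits are all linear extensions of group homomorphisms from \<open>G \<times> G\<close> to
  \<open>G \<times> G \<times> G\<close> or \<open>G\<close>, hence are algebra homomorphisms. Consequently a twist stays a twist under
  any group homomorphism, so each \<open>L\<^sub>i\<close> is a twist for \<open>\<complex>[G]\<close>; and for two twists \<open>L\<close>, \<open>K\<close>
  \<open>(\<Delta> \<otimes> I)(L K) (L K)\<^sub>1\<^sub>2 = (\<Delta> \<otimes> I)(L) (\<Delta> \<otimes> I)(K) L\<^sub>1\<^sub>2 K\<^sub>1\<^sub>2\<close>, which equals \<open>(\<Delta> \<otimes> I)(L) L\<^sub>1\<^sub>2 (\<Delta> \<otimes> I)(K) K\<^sub>1\<^sub>2\<close> as soon as the two middle factors commute.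
  Now \<open>(\<Delta> \<otimes> I)(K)\<close> is a combination of elements \<open>a \<otimes> a \<otimes> b\<close> with \<open>(a, b)\<close> in the support of \<open>K\<close>,
  so it is enough that every such \<open>a \<otimes> a\<close> commutes with \<open>L\<close>, and symmetrically every \<open>b \<otimes> b\<close>
  (\<open>is_twist_mult\<close>). For \<open>L = L\<^sub>i\<close> and \<open>K = L\<^sub>i\<^sub>-\<^sub>1 \<cdots> L\<^sub>1\<close>, whose support lies in
  \<open>G\<^sub>i\<^sub>-\<^sub>1 \<times> G\<^sub>i\<^sub>-\<^sub>1\<close>, this is exactly the invariance of \<open>J\<^sub>i\<close> under \<open>G\<^sub>i\<^sub>-\<^sub>1\<close>. The induction
  on the number of factors thus takes place inside the fixed group \<open>G = G\<^sub>n\<close>.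
\<close>

section \<open>Elements of a group algebra as functionals\<close>

text \<open>
  An element of \<open>\<complex>[X]\<close> is determined by its pairings with all functions on \<open>X\<close>. On this side,
  pushing forward is substitution and convolution is an iterated pairing, so identities in
  group algebras become identities between group elements, free of sums over fibres.
\<close>

definition pairing :: "'x set \<Rightarrow> ('x \<Rightarrow> complex) \<Rightarrow> ('x \<Rightarrow> complex) \<Rightarrow> complex" where
  "pairing X u f = (\<Sum>x\<in>X. u x * f x)"

lemma pairing_eqI:
  assumes "finite X" and "\<And>x. x \<notin> X \<Longrightarrow> u x = 0" and "\<And>x. x \<notin> X \<Longrightarrow> v x = 0"
    and "\<And>f. pairing X u f = pairing X v f"
  shows "u = v"
proof
  fix y
  have *: "pairing X w (\<lambda>x. if x = y then 1 else 0) = (if y \<in> X then w y else 0)" for w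
    using assms(1) by (simp add: pairing_def if_distrib [of "(*) _"] sum.delta cong: if_cong)
  show "u y = v y"
    using assms(2,3) assms(4) [of "\<lambda>x. if x = y then 1 else 0"] unfolding *
    by (cases "y \<in> X") auto
qed

text \<open>
  The test functions need to agree on the support of \<open>u\<close> only; this is what turns
  a condition on the support into commutation in the algebra.
\<close>

lemma pairing_cong:
  assumes "\<And>x. x \<in> X \<Longrightarrow> u x \<noteq> 0 \<Longrightarrow> f x = g x"
  shows "pairing X u f = pairing X u g"
  unfolding pairing_def using assms by (intro sum.cong) auto

lemma pairing_swap:
  "pairing X u (\<lambda>a. pairing Y v (F a)) = pairing Y v (\<lambda>b. pairing X u (\<lambda>a. F a b))"
  unfolding pairing_def sum_distrib_left
  by (subst sum.swap) (simp add: mult_ac)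

lemma pairing_lin_ext:
  assumes "finite X" "finite Y" "h ` X \<subseteq> Y"
  shows "pairing Y (lin_ext X h u) f = pairing X u (\<lambda>x. f (h x))"
proof -
  have "pairing Y (lin_ext X h u) f = (\<Sum>y\<in>Y. \<Sum>x\<in>{x \<in> X. h x = y}. u x * f (h x))"
    by (auto simp: pairing_def lin_ext_def sum_distrib_right intro!: sum.cong)
  also have "\<dots> = pairing X u (\<lambda>x. f (h x))"
    unfolding pairing_def by (rule sum.group [OF assms])
  finally show ?thesis .
qed

lemma lin_ext_support:
  assumes "lin_ext X h u y \<noteq> 0"
  obtains x where "x \<in> X" "h x = y" "u x \<noteq> 0"
  using assms unfolding lin_ext_def by (auto elim: sum.not_neutral_contains_not_neutral)

lemma lin_ext_eq_0: "y \<notin> h ` X \<Longrightarrow> lin_ext X h u y = 0"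
  by (rule ccontr) (auto elim: lin_ext_support)

lemma lin_ext_cong:
  "(\<And>x. x \<in> X \<Longrightarrow> f x = g x) \<Longrightarrow> lin_ext X f u = lin_ext X g u"
  by (auto simp: lin_ext_def intro!: sum.cong)

lemma lin_ext_lin_ext:
  assumes "finite X" "finite Y" "f ` X \<subseteq> Y"
  shows "lin_ext Y g (lin_ext X f u) = lin_ext X (\<lambda>x. g (f x)) u"
proof (rule pairing_eqI [where X = "g ` Y"])
  show "finite (g ` Y)" using assms by simp
  show "lin_ext Y g (lin_ext X f u) y = 0" if "y \<notin> g ` Y" for y
    using that by (rule lin_ext_eq_0)
  show "lin_ext X (\<lambda>x. g (f x)) u y = 0" if "y \<notin> g ` Y" for y
    using that assms by (intro lin_ext_eq_0) auto
  fix h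
  have "pairing (g ` Y) (lin_ext Y g (lin_ext X f u)) h = pairing Y (lin_ext X f u) (\<lambda>y. h (g y))"
    using assms by (intro pairing_lin_ext) auto
  also have "\<dots> = pairing X u (\<lambda>x. h (g (f x)))"
    using assms by (rule pairing_lin_ext)
  also have "\<dots> = pairing (g ` Y) (lin_ext X (\<lambda>x. g (f x)) u) h"
    using assms by (intro pairing_lin_ext [symmetric]) auto
  finally show "pairing (g ` Y) (lin_ext Y g (lin_ext X f u)) h =
      pairing (g ` Y) (lin_ext X (\<lambda>x. g (f x)) u) h" .
qed

lemma lin_ext_carrier:
  "h ` X \<subseteq> carrier K \<Longrightarrow> lin_ext X h u \<in> carrier (group_algebra K)"
  by (auto simp: group_algebra_def intro!: lin_ext_eq_0)


section \<open>The group algebra as a monoid\<close>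

text \<open>
  Convolution is an associative unital product on \<open>\<complex>[G]\<close> for every finite monoid \<open>G\<close>; finite monoids
  are closed under products, so that \<open>G\<close>, \<open>G \<times> G\<close> and \<open>G \<times> G \<times> G\<close> are treated uniformly.
\<close>

locale finite_monoid = Group.monoid G for G (structure) +
  assumes finite_carrier [simp]: "finite (carrier G)"

lemma finite_monoid_group: "group G \<Longrightarrow> finite (carrier G) \<Longrightarrow> finite_monoid G"
  by (simp add: finite_monoid_def finite_monoid_axioms_def group.is_monoid)

lemma finite_monoid_DirProd:
  "finite_monoid G \<Longrightarrow> finite_monoid K \<Longrightarrow> finite_monoid (G \<times>\<times> K)"
  by (simp add: finite_monoid_def finite_monoid_axioms_def DirProd_monoid)

context finite_monoid
begin

lemma pairing_mult:
  "pairing (carrier G) (u \<otimes>\<^bsub>group_algebra G\<^esub> v) f =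
   pairing (carrier G) u (\<lambda>a. pairing (carrier G) v (\<lambda>b. f (a \<otimes> b)))"
proof -
  have "u \<otimes>\<^bsub>group_algebra G\<^esub> v =
        lin_ext (carrier G \<times> carrier G) (\<lambda>(a, b). a \<otimes> b) (\<lambda>(a, b). u a * v b)"
    by (auto simp: group_algebra_def lin_ext_def fun_eq_iff intro!: sum.cong)
  then have "pairing (carrier G) (u \<otimes>\<^bsub>group_algebra G\<^esub> v) f =
      pairing (carrier G \<times> carrier G) (\<lambda>(a, b). u a * v b) (\<lambda>x. f (case x of (a, b) \<Rightarrow> a \<otimes> b))"
    by (simp only:) (rule pairing_lin_ext; auto)
  then show ?thesis
    by (simp add: pairing_def sum_distrib_left sum.cartesian_product mult_ac split_def)
qed

lemma pairing_one: "pairing (carrier G) \<one>\<^bsub>group_algebra G\<^esub> f = f \<one>"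
  by (simp add: pairing_def group_algebra_def if_distrib [of "\<lambda>c. c * _"] sum.delta cong: if_cong)

lemma group_algebra_eqI:
  assumes "u \<in> carrier (group_algebra G)" "v \<in> carrier (group_algebra G)"
    and "\<And>f. pairing (carrier G) u f = pairing (carrier G) v f"
  shows "u = v"
  by (rule pairing_eqI [OF finite_carrier]) (use assms in \<open>auto simp: group_algebra_def\<close>)

lemma mult_support:
  assumes "(u \<otimes>\<^bsub>group_algebra G\<^esub> v) g \<noteq> 0"
  obtains a b where "a \<in> carrier G" "b \<in> carrier G" "g = a \<otimes> b" "u a \<noteq> 0" "v b \<noteq> 0"
proof -
  obtain p where "p \<in> {(a, b). (a, b) \<in> carrier G \<times> carrier G \<and> a \<otimes> b = g}"
      and "(case p of (a, b) \<Rightarrow> u a * v b) \<noteq> 0"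
    using assms by (auto simp: group_algebra_def elim: sum.not_neutral_contains_not_neutral)
  then show thesis
    by (cases p) (auto intro!: that [of "fst p" "snd p"])
qed

lemma mult_carrier: "u \<otimes>\<^bsub>group_algebra G\<^esub> v \<in> carrier (group_algebra G)"
proof -
  have "(u \<otimes>\<^bsub>group_algebra G\<^esub> v) g = 0" if "g \<notin> carrier G" for g
    using that by (metis mult_support m_closed)
  then show ?thesis
    by (simp add: group_algebra_def)
qed

lemma one_carrier: "\<one>\<^bsub>group_algebra G\<^esub> \<in> carrier (group_algebra G)"
  by (auto simp: group_algebra_def)

lemma monoid_group_algebra: "Group.monoid (group_algebra G)"
proof (rule monoidI)
  show "u \<otimes>\<^bsub>group_algebra G\<^esub> v \<otimes>\<^bsub>group_algebra G\<^esub> w =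
        u \<otimes>\<^bsub>group_algebra G\<^esub> (v \<otimes>\<^bsub>group_algebra G\<^esub> w)" for u v w
    by (rule group_algebra_eqI)
       (auto simp: mult_carrier pairing_mult m_assoc intro!: pairing_cong)
  show "\<one>\<^bsub>group_algebra G\<^esub> \<otimes>\<^bsub>group_algebra G\<^esub> u = u"
    if "u \<in> carrier (group_algebra G)" for u
    using that
    by (intro group_algebra_eqI) (auto simp: mult_carrier pairing_mult pairing_one intro!: pairing_cong)
  show "u \<otimes>\<^bsub>group_algebra G\<^esub> \<one>\<^bsub>group_algebra G\<^esub> = u"
    if "u \<in> carrier (group_algebra G)" for u
    using that
    by (intro group_algebra_eqI) (auto simp: mult_carrier pairing_mult pairing_one intro!: pairing_cong)
qed (simp_all add: mult_carrier one_carrier)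

end

lemma lin_ext_one:
  assumes "finite_monoid G" "finite_monoid K" "h \<in> hom G K" "h \<one>\<^bsub>G\<^esub> = \<one>\<^bsub>K\<^esub>"
  shows "lin_ext (carrier G) h \<one>\<^bsub>group_algebra G\<^esub> = \<one>\<^bsub>group_algebra K\<^esub>"
proof -
  interpret G: finite_monoid G by fact
  interpret K: finite_monoid K by fact
  have h: "h ` carrier G \<subseteq> carrier K" using assms(3) by (auto simp: hom_def)
  show ?thesis
    by (rule K.group_algebra_eqI)
       (use h assms(4) in \<open>auto simp: lin_ext_carrier K.one_carrier pairing_lin_ext
          G.pairing_one K.pairing_one\<close>)
qed

text \<open>
  Functoriality of \<open>G \<mapsto> \<complex>[G]\<close>: linear extensions of monoid homomorphisms are algebra homomorphisms.
\<close>

lemma lin_ext_mult: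
  assumes "finite_monoid G" "finite_monoid K" "h \<in> hom G K"
  shows "lin_ext (carrier G) h (u \<otimes>\<^bsub>group_algebra G\<^esub> v) =
         lin_ext (carrier G) h u \<otimes>\<^bsub>group_algebra K\<^esub> lin_ext (carrier G) h v"
proof -
  interpret G: finite_monoid G by fact
  interpret K: finite_monoid K by fact
  have h: "h ` carrier G \<subseteq> carrier K" using assms(3) by (auto simp: hom_def)
  show ?thesis
    by (rule K.group_algebra_eqI)
       (use h assms(3) in \<open>auto simp: lin_ext_carrier K.mult_carrier pairing_lin_ext
          G.pairing_mult K.pairing_mult hom_mult intro!: pairing_cong\<close>)
qed

lemma lin_ext_Units:
  assumes "finite_monoid G" "finite_monoid K" "h \<in> hom G K" "h \<one>\<^bsub>G\<^esub> = \<one>\<^bsub>K\<^esub>"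
    and "u \<in> Units (group_algebra G)"
  shows "lin_ext (carrier G) h u \<in> Units (group_algebra K)"
proof -
  have h: "h ` carrier G \<subseteq> carrier K" using assms(3) by (auto simp: hom_def)
  obtain v where "v \<otimes>\<^bsub>group_algebra G\<^esub> u = \<one>\<^bsub>group_algebra G\<^esub>"
      and "u \<otimes>\<^bsub>group_algebra G\<^esub> v = \<one>\<^bsub>group_algebra G\<^esub>"
    using assms(5) by (auto simp: Units_def)
  then have "lin_ext (carrier G) h v \<otimes>\<^bsub>group_algebra K\<^esub> lin_ext (carrier G) h u = \<one>\<^bsub>group_algebra K\<^esub>"
      and "lin_ext (carrier G) h u \<otimes>\<^bsub>group_algebra K\<^esub> lin_ext (carrier G) h v = \<one>\<^bsub>group_algebra K\<^esub>"
    using assms(1-4) by (simp_all flip: lin_ext_mult add: lin_ext_one)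
  then show ?thesis
    using lin_ext_carrier [OF h] by (auto simp: Units_def)
qed


section \<open>Centralizers in the group\<close>

text \<open>
  The equation says \<open>a v = v a\<close> in \<open>\<complex>[G]\<close>, tested against all functions \<open>f\<close>; these are the elements
  of the monoid that commute with \<open>v\<close>.
\<close>

definition centralizer :: "('g, 'm) monoid_scheme \<Rightarrow> ('g \<Rightarrow> complex) \<Rightarrow> 'g set" where
  "centralizer G v = {a \<in> carrier G. \<forall>f.
     pairing (carrier G) v (\<lambda>b. f (a \<otimes>\<^bsub>G\<^esub> b)) = pairing (carrier G) v (\<lambda>b. f (b \<otimes>\<^bsub>G\<^esub> a))}"

context finite_monoid
begin

lemma centralizer_one: "\<one> \<in> centralizer G v"
  by (auto simp: centralizer_def intro!: pairing_cong)

lemma centralizer_mult: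
  assumes "a \<in> centralizer G v" "b \<in> centralizer G v"
  shows "a \<otimes> b \<in> centralizer G v"
proof -
  have G: "a \<in> carrier G" "b \<in> carrier G"
    using assms by (auto simp: centralizer_def)
  have "pairing (carrier G) v (\<lambda>c. f (a \<otimes> b \<otimes> c)) = pairing (carrier G) v (\<lambda>c. f (c \<otimes> (a \<otimes> b)))" for f
  proof -
    have "pairing (carrier G) v (\<lambda>c. f (a \<otimes> b \<otimes> c)) = pairing (carrier G) v (\<lambda>c. f (a \<otimes> (b \<otimes> c)))"
      using G by (auto simp: m_assoc intro!: pairing_cong)
    also have "\<dots> = pairing (carrier G) v (\<lambda>c. f (a \<otimes> (c \<otimes> b)))"
      using assms(2) unfolding centralizer_def by (auto dest: spec [of _ "\<lambda>x. f (a \<otimes> x)"])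
    also have "\<dots> = pairing (carrier G) v (\<lambda>c. f ((a \<otimes> c) \<otimes> b))"
      using G by (auto simp: m_assoc intro!: pairing_cong)
    also have "\<dots> = pairing (carrier G) v (\<lambda>c. f ((c \<otimes> a) \<otimes> b))"
      using assms(1) unfolding centralizer_def by (auto dest: spec [of _ "\<lambda>x. f (x \<otimes> b)"])
    also have "\<dots> = pairing (carrier G) v (\<lambda>c. f (c \<otimes> (a \<otimes> b)))"
      using G by (auto simp: m_assoc intro!: pairing_cong)
    finally show ?thesis .
  qed
  with G show ?thesis
    by (simp add: centralizer_def)
qed

text \<open>
  By linearity in \<open>u\<close>, commuting with \<open>v\<close> can be checked on the monoid elements that occur in \<open>u\<close>.
\<close>

lemma mult_commute_centralizer:
  assumes "\<And>a. a \<in> carrier G \<Longrightarrow> u a \<noteq> 0 \<Longrightarrow> a \<in> centralizer G v"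
  shows "u \<otimes>\<^bsub>group_algebra G\<^esub> v = v \<otimes>\<^bsub>group_algebra G\<^esub> u"
proof (rule group_algebra_eqI)
  fix f
  have "pairing (carrier G) (u \<otimes>\<^bsub>group_algebra G\<^esub> v) f =
        pairing (carrier G) u (\<lambda>a. pairing (carrier G) v (\<lambda>b. f (b \<otimes> a)))"
    unfolding pairing_mult
    by (rule pairing_cong) (use assms in \<open>auto simp: centralizer_def\<close>)
  also have "\<dots> = pairing (carrier G) (v \<otimes>\<^bsub>group_algebra G\<^esub> u) f"
    unfolding pairing_mult by (rule pairing_swap)
  finally show "pairing (carrier G) (u \<otimes>\<^bsub>group_algebra G\<^esub> v) f =
                pairing (carrier G) (v \<otimes>\<^bsub>group_algebra G\<^esub> u) f" .
qed (simp_all add: mult_carrier)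

end


section \<open>Twists\<close>

context finite_monoid
begin

lemma finite_monoid_square: "finite_monoid (G \<times>\<times> G)"
  by (intro finite_monoid_DirProd finite_monoid_axioms)

lemma finite_monoid_cube: "finite_monoid (G \<times>\<times> G \<times>\<times> G)"
  by (intro finite_monoid_DirProd finite_monoid_axioms)

lemma hom_square_cube:
  "(\<lambda>(a, c). (a, a, c)) \<in> hom (G \<times>\<times> G) (G \<times>\<times> G \<times>\<times> G)"
  "(\<lambda>(a, c). (a, c, c)) \<in> hom (G \<times>\<times> G) (G \<times>\<times> G \<times>\<times> G)"
  "(\<lambda>(a, c). (a, c, \<one>)) \<in> hom (G \<times>\<times> G) (G \<times>\<times> G \<times>\<times> G)"
  "(Pair \<one>) \<in> hom (G \<times>\<times> G) (G \<times>\<times> G \<times>\<times> G)"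
  "fst \<in> hom (G \<times>\<times> G) G" "snd \<in> hom (G \<times>\<times> G) G"
  by (auto simp: hom_def)

text \<open>
  Since \<open>\<Delta> g = g \<otimes> g\<close> and \<open>\<epsilon> g = 1\<close> for \<open>g \<in> G\<close>, all maps in the definition of a twist permute,
  repeat, drop or insert group elements, so they are linear extensions of homomorphisms between
  powers of \<open>G\<close>. The hypothesis on \<open>J\<close> matters because the coefficientwise definitions also
  read the coefficients of \<open>J\<close> outside \<open>G \<times> G\<close>.
\<close>

lemma structure_maps_eq_lin_ext:
  assumes "J \<in> carrier (group_algebra (G \<times>\<times> G))"
  shows "coproduct_id G J = lin_ext (carrier G \<times> carrier G) (\<lambda>(a, c). (a, a, c)) J"
    and "id_coproduct G J = lin_ext (carrier G \<times> carrier G) (\<lambda>(a, c). (a, c, c)) J"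
    and "leg12 G J = lin_ext (carrier G \<times> carrier G) (\<lambda>(a, c). (a, c, \<one>)) J"
    and "leg23 G J = lin_ext (carrier G \<times> carrier G) (Pair \<one>) J"
    and "counit_id G J = lin_ext (carrier G \<times> carrier G) snd J"
    and "id_counit G J = lin_ext (carrier G \<times> carrier G) fst J"
proof -
  have J: "J (a, b) = 0" if "a \<notin> carrier G \<or> b \<notin> carrier G" for a b
    using assms that by (auto simp: group_algebra_def)
  show "coproduct_id G J = lin_ext (carrier G \<times> carrier G) (\<lambda>(a, c). (a, a, c)) J"
  proof (clarsimp simp: fun_eq_iff coproduct_id_def coproduct_def)
    fix a b c
    have "{x \<in> carrier G. (x, x) = (a, b)} = (if a = b \<and> a \<in> carrier G then {a} else {})"
      by auto
    moreover have "{p \<in> carrier G \<times> carrier G. (case p of (a, c) \<Rightarrow> (a, a, c)) = (a, b, c)} =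
        (if a = b \<and> a \<in> carrier G \<and> c \<in> carrier G then {(a, c)} else {})"
      by auto
    ultimately show "lin_ext (carrier G) (\<lambda>g. (g, g)) (\<lambda>x. J (x, c)) (a, b) =
        lin_ext (carrier G \<times> carrier G) (\<lambda>(a, c). (a, a, c)) J (a, b, c)"
      using J by (auto simp: lin_ext_def)
  qed
  show "id_coproduct G J = lin_ext (carrier G \<times> carrier G) (\<lambda>(a, c). (a, c, c)) J"
  proof (clarsimp simp: fun_eq_iff id_coproduct_def coproduct_def)
    fix a b c
    have "{x \<in> carrier G. (x, x) = (b, c)} = (if b = c \<and> b \<in> carrier G then {b} else {})"
      by auto
    moreover have "{p \<in> carrier G \<times> carrier G. (case p of (a, c) \<Rightarrow> (a, c, c)) = (a, b, c)} =
        (if b = c \<and> a \<in> carrier G \<and> c \<in> carrier G then {(a, c)} else {})"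
      by auto
    ultimately show "lin_ext (carrier G) (\<lambda>g. (g, g)) (\<lambda>x. J (a, x)) (b, c) =
        lin_ext (carrier G \<times> carrier G) (\<lambda>(a, c). (a, c, c)) J (a, b, c)"
      using J by (auto simp: lin_ext_def)
  qed
  show "leg12 G J = lin_ext (carrier G \<times> carrier G) (\<lambda>(a, c). (a, c, \<one>)) J"
  proof (clarsimp simp: fun_eq_iff leg12_def)
    fix a b c
    have "{p \<in> carrier G \<times> carrier G. (case p of (a, c) \<Rightarrow> (a, c, \<one>)) = (a, b, c)} =
        (if c = \<one> \<and> a \<in> carrier G \<and> b \<in> carrier G then {(a, b)} else {})"
      by auto
    then show "J (a, b) * \<one>\<^bsub>group_algebra G\<^esub> c =
        lin_ext (carrier G \<times> carrier G) (\<lambda>(a, c). (a, c, \<one>)) J (a, b, c)"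
      using J by (auto simp: lin_ext_def group_algebra_def)
  qed
  show "leg23 G J = lin_ext (carrier G \<times> carrier G) (Pair \<one>) J"
  proof (clarsimp simp: fun_eq_iff leg23_def)
    fix a b c
    have "{p \<in> carrier G \<times> carrier G. (\<one>, p) = (a, b, c)} =
        (if a = \<one> \<and> b \<in> carrier G \<and> c \<in> carrier G then {(b, c)} else {})"
      by auto
    then show "\<one>\<^bsub>group_algebra G\<^esub> a * J (b, c) =
        lin_ext (carrier G \<times> carrier G) (Pair \<one>) J (a, b, c)"
      using J by (auto simp: lin_ext_def group_algebra_def)
  qed
  show "counit_id G J = lin_ext (carrier G \<times> carrier G) snd J"
  proof
    fix b
    have "lin_ext (carrier G \<times> carrier G) snd J b = (\<Sum>a\<in>carrier G. J (a, b))"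
    proof (cases "b \<in> carrier G")
      case True
      then have "{p \<in> carrier G \<times> carrier G. snd p = b} = (\<lambda>a. (a, b)) ` carrier G"
        by auto
      then show ?thesis
        by (simp add: lin_ext_def sum.reindex inj_on_def)
    next
      case False
      then show ?thesis
        using J by (subst lin_ext_eq_0) auto
    qed
    then show "counit_id G J b = lin_ext (carrier G \<times> carrier G) snd J b"
      by (simp add: counit_id_def counit_def)
  qed
  show "id_counit G J = lin_ext (carrier G \<times> carrier G) fst J"
  proof
    fix a
    have "lin_ext (carrier G \<times> carrier G) fst J a = (\<Sum>b\<in>carrier G. J (a, b))"
    proof (cases "a \<in> carrier G")
      case True
      then have "{p \<in> carrier G \<times> carrier G. fst p = a} = (\<lambda>b. (a, b)) ` carrier G"
        by auto
      then show ?thesis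
        by (simp add: lin_ext_def sum.reindex inj_on_def)
    next
      case False
      then show ?thesis
        using J by (subst lin_ext_eq_0) auto
    qed
    then show "id_counit G J a = lin_ext (carrier G \<times> carrier G) fst J a"
      by (simp add: id_counit_def counit_def)
  qed
qed

lemma is_twist_iff:
  "is_twist G J \<longleftrightarrow>
     J \<in> Units (group_algebra (G \<times>\<times> G)) \<and>
     lin_ext (carrier G \<times> carrier G) (\<lambda>(a, c). (a, a, c)) J
       \<otimes>\<^bsub>group_algebra (G \<times>\<times> G \<times>\<times> G)\<^esub> lin_ext (carrier G \<times> carrier G) (\<lambda>(a, c). (a, c, \<one>)) J =
     lin_ext (carrier G \<times> carrier G) (\<lambda>(a, c). (a, c, c)) J
       \<otimes>\<^bsub>group_algebra (G \<times>\<times> G \<times>\<times> G)\<^esub> lin_ext (carrier G \<times> carrier G) (Pair \<one>) J \<and>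
     lin_ext (carrier G \<times> carrier G) snd J = \<one>\<^bsub>group_algebra G\<^esub> \<and>
     lin_ext (carrier G \<times> carrier G) fst J = \<one>\<^bsub>group_algebra G\<^esub>"
proof (cases "J \<in> Units (group_algebra (G \<times>\<times> G))")
  case True
  then have "J \<in> carrier (group_algebra (G \<times>\<times> G))"
    by (simp add: Units_def)
  then show ?thesis
    by (simp add: is_twist_def structure_maps_eq_lin_ext)
next
  case False
  then show ?thesis by (simp add: is_twist_def)
qed

lemma is_twist_one: "is_twist G \<one>\<^bsub>group_algebra (G \<times>\<times> G)\<^esub>"
proof -
  note sq = finite_monoid_square and cu = finite_monoid_cube
  interpret sq: Group.monoid "group_algebra (G \<times>\<times> G)"
    using sq by (rule finite_monoid.monoid_group_algebra)
  note * = lin_ext_one [OF sq cu, unfolded carrier_DirProd]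
    lin_ext_one [OF sq finite_monoid_axioms, unfolded carrier_DirProd]
  show ?thesis
    unfolding is_twist_iff by (simp add: * hom_square_cube)
qed

text \<open>
  The hypothesis lets \<open>(\<Delta> \<otimes> I)(K)\<close> pass through \<open>L\<^sub>1\<^sub>2\<close> and \<open>(I \<otimes> \<Delta>)(K)\<close> pass through \<open>L\<^sub>2\<^sub>3\<close>, after
  which the two twist equations multiply.
\<close>

lemma is_twist_mult:
  assumes L: "is_twist G L" and K: "is_twist G K"
    and central: "\<And>a b. K (a, b) \<noteq> 0 \<Longrightarrow>
      (a, a) \<in> centralizer (G \<times>\<times> G) L \<and> (b, b) \<in> centralizer (G \<times>\<times> G) L"
  shows "is_twist G (L \<otimes>\<^bsub>group_algebra (G \<times>\<times> G)\<^esub> K)"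
proof -
  note sq = finite_monoid_square and cu = finite_monoid_cube
  interpret sq: Group.monoid "group_algebra (G \<times>\<times> G)"
    using sq by (rule finite_monoid.monoid_group_algebra)
  interpret cu: Group.monoid "group_algebra (G \<times>\<times> G \<times>\<times> G)"
    using cu by (rule finite_monoid.monoid_group_algebra)
  interpret GA: Group.monoid "group_algebra G"
    by (rule monoid_group_algebra)
  let ?X = "carrier G \<times> carrier G"
  let ?m = "mult (group_algebra (G \<times>\<times> G \<times>\<times> G))"
  let ?d1 = "lin_ext ?X (\<lambda>(a, c). (a, a, c))" and ?d2 = "lin_ext ?X (\<lambda>(a, c). (a, c, c))"
  let ?i1 = "lin_ext ?X (\<lambda>(a, c). (a, c, \<one>))" and ?i2 = "lin_ext ?X (Pair \<one>)"
  note mult = lin_ext_mult [OF sq cu, unfolded carrier_DirProd]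
    lin_ext_mult [OF sq finite_monoid_axioms, unfolded carrier_DirProd]
  have [simp]: "?d1 u \<in> carrier (group_algebra (G \<times>\<times> G \<times>\<times> G))"
    "?d2 u \<in> carrier (group_algebra (G \<times>\<times> G \<times>\<times> G))"
    "?i1 u \<in> carrier (group_algebra (G \<times>\<times> G \<times>\<times> G))"
    "?i2 u \<in> carrier (group_algebra (G \<times>\<times> G \<times>\<times> G))" for u
    by (auto intro!: lin_ext_carrier)
  \<comment> \<open>\<open>(\<Delta> \<otimes> I)(K)\<close> is supported on triples \<open>(a, a, c)\<close>, and the third leg of \<open>L\<^sub>1\<^sub>2\<close> is trivial,
    so only \<open>(a, a)\<close> has to commute with \<open>L\<close>.\<close>
  have c1: "?m (?d1 K) (?i1 L) = ?m (?i1 L) (?d1 K)"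
  proof (rule finite_monoid.mult_commute_centralizer [OF cu])
    fix p assume p: "?d1 K p \<noteq> 0"
    then obtain a c where p_eq: "p = (a, a, c)" and G: "a \<in> carrier G" "c \<in> carrier G" and "K (a, c) \<noteq> 0"
      by (auto elim!: lin_ext_support)
    with central have *: "pairing ?X L (\<lambda>q. f ((a, a) \<otimes>\<^bsub>G \<times>\<times> G\<^esub> q)) =
        pairing ?X L (\<lambda>q. f (q \<otimes>\<^bsub>G \<times>\<times> G\<^esub> (a, a)))" for f
      by (auto simp: centralizer_def)
    show "p \<in> centralizer (G \<times>\<times> G \<times>\<times> G) (?i1 L)"
      using G * [of "\<lambda>(x, y). f (x, y, c)" for f]
      by (auto simp: centralizer_def p_eq pairing_lin_ext image_subset_iff split_def mult_DirProd')
  qed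
  have c2: "?m (?d2 K) (?i2 L) = ?m (?i2 L) (?d2 K)"
  proof (rule finite_monoid.mult_commute_centralizer [OF cu])
    fix p assume p: "?d2 K p \<noteq> 0"
    then obtain a c where p_eq: "p = (a, c, c)" and G: "a \<in> carrier G" "c \<in> carrier G" and "K (a, c) \<noteq> 0"
      by (auto elim!: lin_ext_support)
    with central have *: "pairing ?X L (\<lambda>q. f ((c, c) \<otimes>\<^bsub>G \<times>\<times> G\<^esub> q)) =
        pairing ?X L (\<lambda>q. f (q \<otimes>\<^bsub>G \<times>\<times> G\<^esub> (c, c)))" for f
      by (auto simp: centralizer_def)
    show "p \<in> centralizer (G \<times>\<times> G \<times>\<times> G) (?i2 L)"
      using G * [of "\<lambda>(x, y). f (a, x, y)" for f]
      by (auto simp: centralizer_def p_eq pairing_lin_ext image_subset_iff split_def mult_DirProd')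
  qed
  have exch: "?m (?m a b) (?m c d) = ?m (?m a c) (?m b d)"
    if "?m b c = ?m c b" and "a \<in> carrier (group_algebra (G \<times>\<times> G \<times>\<times> G))"
      "b \<in> carrier (group_algebra (G \<times>\<times> G \<times>\<times> G))" "c \<in> carrier (group_algebra (G \<times>\<times> G \<times>\<times> G))"
      "d \<in> carrier (group_algebra (G \<times>\<times> G \<times>\<times> G))" for a b c d
    using that by (metis cu.m_assoc cu.m_closed)
  have "?m (?m (?d1 L) (?d1 K)) (?m (?i1 L) (?i1 K)) = ?m (?m (?d1 L) (?i1 L)) (?m (?d1 K) (?i1 K))"
    by (rule exch [OF c1]) simp_all
  also have "\<dots> = ?m (?m (?d2 L) (?i2 L)) (?m (?d2 K) (?i2 K))"
    using L K by (simp add: is_twist_iff)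
  also have "\<dots> = ?m (?m (?d2 L) (?d2 K)) (?m (?i2 L) (?i2 K))"
    by (rule exch [OF c2, symmetric]) simp_all
  finally have "?m (?m (?d1 L) (?d1 K)) (?m (?i1 L) (?i1 K)) = ?m (?m (?d2 L) (?d2 K)) (?m (?i2 L) (?i2 K))" .
  then show ?thesis
    using L K unfolding is_twist_iff by (simp add: mult hom_square_cube)
qed

end

text \<open>
  Homomorphisms commute with the duplication, insertion and projection maps, hence carry the
  equations for \<open>J\<close> to those for its image.
\<close>

lemma is_twist_lin_ext:
  assumes "finite_monoid G" "finite_monoid K" "e \<in> hom G K" "e \<one>\<^bsub>G\<^esub> = \<one>\<^bsub>K\<^esub>" and J: "is_twist G J"
  shows "is_twist K (lin_ext (carrier G \<times> carrier G) (map_prod e e) J)"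
proof -
  interpret G: finite_monoid G by fact
  interpret K: finite_monoid K by fact
  let ?X = "carrier G \<times> carrier G"
  let ?Y = "carrier K \<times> carrier K"
  let ?e3 = "map_prod e (map_prod e e)"
  have e: "e x \<in> carrier K" if "x \<in> carrier G" for x
    using assms(3) that by (auto simp: hom_def)
  have e2: "map_prod e e \<in> hom (G \<times>\<times> G) (K \<times>\<times> K)"
    and e3: "?e3 \<in> hom (G \<times>\<times> G \<times>\<times> G) (K \<times>\<times> K \<times>\<times> K)"
    using assms(3) by (auto simp: hom_def)
  have unit: "lin_ext ?X (map_prod e e) J \<in> Units (group_algebra (K \<times>\<times> K))"
    using lin_ext_Units [OF G.finite_monoid_square K.finite_monoid_square e2] J assms(4)
    by (simp add: is_twist_def)
  have push: "lin_ext ?Y d' (lin_ext ?X (map_prod e e) J) = lin_ext Z e' (lin_ext ?X d J)"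
    if "\<And>x. x \<in> ?X \<Longrightarrow> d' (map_prod e e x) = e' (d x)" "d ` ?X \<subseteq> Z" "finite Z" for d d' e' Z
    using that e by (subst (1 2) lin_ext_lin_ext) (auto intro!: lin_ext_cong)
  let ?Z = "carrier (G \<times>\<times> G \<times>\<times> G)"
  have 1: "lin_ext ?Y (\<lambda>(a, c). (a, a, c)) (lin_ext ?X (map_prod e e) J) =
        lin_ext ?Z ?e3 (lin_ext ?X (\<lambda>(a, c). (a, a, c)) J)"
    by (rule push) auto
  have 2: "lin_ext ?Y (\<lambda>(a, c). (a, c, c)) (lin_ext ?X (map_prod e e) J) =
        lin_ext ?Z ?e3 (lin_ext ?X (\<lambda>(a, c). (a, c, c)) J)"
    by (rule push) auto
  have 3: "lin_ext ?Y (\<lambda>(a, c). (a, c, \<one>\<^bsub>K\<^esub>)) (lin_ext ?X (map_prod e e) J) =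
        lin_ext ?Z ?e3 (lin_ext ?X (\<lambda>(a, c). (a, c, \<one>\<^bsub>G\<^esub>)) J)"
    by (rule push) (auto simp: assms(4))
  have 4: "lin_ext ?Y (Pair \<one>\<^bsub>K\<^esub>) (lin_ext ?X (map_prod e e) J) =
        lin_ext ?Z ?e3 (lin_ext ?X (Pair \<one>\<^bsub>G\<^esub>) J)"
    by (rule push) (auto simp: assms(4))
  have 5: "lin_ext ?Y snd (lin_ext ?X (map_prod e e) J) = lin_ext (carrier G) e (lin_ext ?X snd J)"
    by (rule push) auto
  have 6: "lin_ext ?Y fst (lin_ext ?X (map_prod e e) J) = lin_ext (carrier G) e (lin_ext ?X fst J)"
    by (rule push) auto
  show ?thesis
    unfolding K.is_twist_iff 1 2 3 4 5 6
    using unit J unfolding G.is_twist_iff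
    by (simp only: lin_ext_mult [OF G.finite_monoid_cube K.finite_monoid_cube e3, symmetric]
        lin_ext_one [OF assms(1-4)] simp_thms)
qed


section \<open>Ordered products of pushforwards\<close>

lemma bij_betw_PiE_1: "bij_betw (\<lambda>x. x 1) (\<Pi>\<^sub>E i\<in>{1..1::nat}. F i) (F 1)"
proof (rule bij_betw_byWitness [where f' = "\<lambda>a. \<lambda>i\<in>{1..1}. a"])
  have "(\<lambda>i\<in>{1..1}. x 1) = x" if "x \<in> (\<Pi>\<^sub>E i\<in>{1..1::nat}. F i)" for x
  proof -
    have "(\<lambda>i\<in>{1..1}. x 1) = restrict x {1..1}"
      by (rule restrict_ext) simp
    with that show ?thesis by (simp only: PiE_restrict)
  qed
  then show "\<forall>x\<in>\<Pi>\<^sub>E i\<in>{1..1::nat}. F i. (\<lambda>i\<in>{1..1}. x 1) = x"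
    by blast
  have "x 1 \<in> F 1" if "x \<in> (\<Pi>\<^sub>E i\<in>{1..1::nat}. F i)" for x
    using that by (rule PiE_mem) simp
  then show "(\<lambda>x. x 1) ` (\<Pi>\<^sub>E i\<in>{1..1::nat}. F i) \<subseteq> F 1"
    by blast
  show "(\<lambda>a. \<lambda>i\<in>{1..1}. a) ` F 1 \<subseteq> (\<Pi>\<^sub>E i\<in>{1..1::nat}. F i)"
    by (intro image_subsetI PiE_I) auto
qed simp

text \<open>
  Splitting off the last coordinate is the induction step both for the tensor
  \<open>J\<^sub>1 \<otimes> \<cdots> \<otimes> J\<^sub>n\<close> and for the bijectivity of \<open>\<pi>\<close>.
\<close>

lemma bij_betw_PiE_Suc:
  "bij_betw (\<lambda>(a, x). x(Suc k := a)) (F (Suc k) \<times> Pi\<^sub>E {1..k} F) (Pi\<^sub>E {1..Suc k} F)"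
proof (rule bij_betw_byWitness [where f' = "\<lambda>x. (x (Suc k), restrict x {1..k})"])
  have "x (Suc k) \<in> F (Suc k)" if "x \<in> Pi\<^sub>E {1..Suc k} F" for x
    using that by (rule PiE_mem) simp
  then show "(\<lambda>x. (x (Suc k), restrict x {1..k})) ` Pi\<^sub>E {1..Suc k} F \<subseteq> F (Suc k) \<times> Pi\<^sub>E {1..k} F"
    by auto
qed (auto simp: PiE_iff extensional_def fun_eq_iff le_Suc_eq)

lemma sum_PiE_Suc:
  "(\<Sum>x\<in>Pi\<^sub>E {1..Suc k} F. g x) = (\<Sum>a\<in>F (Suc k). \<Sum>x\<in>Pi\<^sub>E {1..k} F. g (x(Suc k := a)))"
  by (subst sum.reindex_bij_betw [OF bij_betw_PiE_Suc, symmetric])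
     (simp add: sum.cartesian_product split_def)

lemma pairing_tensor_family_Suc:
  fixes H :: "nat \<Rightarrow> 'g monoid"
  defines "A \<equiv> \<lambda>k. \<Pi>\<^sub>E i\<in>{1..k}. carrier (H i)"
  shows "pairing (A (Suc k) \<times> A (Suc k)) (tensor_family (Suc k) H J) f =
    pairing (carrier (H (Suc k)) \<times> carrier (H (Suc k))) (J (Suc k)) (\<lambda>(a, b).
      pairing (A k \<times> A k) (tensor_family k H J) (\<lambda>(x, y). f (x(Suc k := a), y(Suc k := b))))"
proof -
  let ?C = "carrier (H (Suc k))"
  have upd: "x(Suc k := a) \<in> A (Suc k)" if "a \<in> ?C" "x \<in> A k" for a x
    using that by (auto simp: A_def PiE_iff extensional_def le_Suc_eq)
  have tensor: "tensor_family (Suc k) H J (x(Suc k := a), y(Suc k := b)) =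
      J (Suc k) (a, b) * tensor_family k H J (x, y)"
    if "a \<in> ?C" "x \<in> A k" "b \<in> ?C" "y \<in> A k" for a b x y
    using upd [OF that(1,2)] upd [OF that(3,4)] that
    by (simp add: tensor_family_def A_def)
  have "pairing (A (Suc k) \<times> A (Suc k)) (tensor_family (Suc k) H J) f =
      (\<Sum>x\<in>A (Suc k). \<Sum>y\<in>A (Suc k). tensor_family (Suc k) H J (x, y) * f (x, y))"
    by (simp add: pairing_def sum.cartesian_product split_def)
  also have "\<dots> = (\<Sum>a\<in>?C. \<Sum>x\<in>A k. \<Sum>b\<in>?C. \<Sum>y\<in>A k.
      tensor_family (Suc k) H J (x(Suc k := a), y(Suc k := b)) * f (x(Suc k := a), y(Suc k := b)))"
    by (simp only: A_def sum_PiE_Suc)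
  also have "\<dots> = (\<Sum>a\<in>?C. \<Sum>b\<in>?C. \<Sum>x\<in>A k. \<Sum>y\<in>A k.
      J (Suc k) (a, b) * tensor_family k H J (x, y) * f (x(Suc k := a), y(Suc k := b)))"
    by (subst sum.swap) (intro sum.cong refl, simp add: tensor)
  also have "\<dots> = pairing (?C \<times> ?C) (J (Suc k)) (\<lambda>(a, b).
      pairing (A k \<times> A k) (tensor_family k H J) (\<lambda>(x, y). f (x(Suc k := a), y(Suc k := b))))"
    by (simp add: pairing_def sum.cartesian_product' sum_distrib_left mult.assoc)
  finally show ?thesis .
qed

lemma desc_prod_cong:
  "(\<And>i. i \<in> {1..k} \<Longrightarrow> x i = y i) \<Longrightarrow> desc_prod M x k = desc_prod M y k"
  by (induction k) auto

lemma (in Group.monoid) desc_prod_closed: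
  "(\<And>i. i \<in> {1..k} \<Longrightarrow> x i \<in> carrier G) \<Longrightarrow> desc_prod G x k \<in> carrier G"
  by (induction k) auto

lemma desc_prod_hom:
  assumes "Group.monoid M" "h \<in> hom M N" "h \<one>\<^bsub>M\<^esub> = \<one>\<^bsub>N\<^esub>"
    and "\<And>i. i \<in> {1..k} \<Longrightarrow> x i \<in> carrier M"
  shows "h (desc_prod M x k) = desc_prod N (\<lambda>i. h (x i)) k"
  using assms(4)
proof (induction k)
  case (Suc k)
  have "desc_prod M x k \<in> carrier M"
    by (rule monoid.desc_prod_closed [OF assms(1)]) (use Suc.prems in auto)
  then show ?case
    using Suc hom_mult [OF assms(2)] by simp
qed (simp add: assms(3))

text \<open>
  Expanding the product of the linear extensions over all choices of basis elements gives, for each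
  pair of families \<open>x\<close>, \<open>y\<close>, the coefficient \<open>\<Prod>\<^sub>i J\<^sub>i (x\<^sub>i, y\<^sub>i)\<close> at \<open>x\<^sub>k \<cdots> x\<^sub>1 \<otimes> y\<^sub>k \<cdots> y\<^sub>1\<close>.
\<close>

lemma desc_prod_lin_ext:
  fixes H :: "nat \<Rightarrow> 'h monoid"
  assumes "finite_monoid G"
    and "\<And>i. i \<in> {1..k} \<Longrightarrow> finite (carrier (H i))"
    and "\<And>i. i \<in> {1..k} \<Longrightarrow> e i ` carrier (H i) \<subseteq> carrier G"
  defines "d \<equiv> \<lambda>k x. desc_prod G (\<lambda>i. e i (x i)) k"
    and "A \<equiv> \<lambda>k. carrier (product_group {1..k} H)"
  shows "desc_prod (group_algebra (G \<times>\<times> G))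
           (\<lambda>i. lin_ext (carrier (H i) \<times> carrier (H i)) (map_prod (e i) (e i)) (J i)) k =
         lin_ext (A k \<times> A k) (map_prod (d k) (d k)) (tensor_family k H J)"
proof -
  interpret G: finite_monoid G by fact
  interpret sq: finite_monoid "G \<times>\<times> G" by (rule G.finite_monoid_square)
  show ?thesis
    using assms(2,3)
  proof (induction k)
    case 0
    have "A 0 = {\<lambda>i. undefined}"
      by (simp add: A_def)
    then show ?case
      by (auto simp: lin_ext_def tensor_family_def A_def d_def group_algebra_def fun_eq_iff Collect_conv_if)
  next
    case (Suc k)
    let ?C = "carrier (H (Suc k))"
    have e: "e i a \<in> carrier G" if "i \<in> {1..Suc k}" "a \<in> carrier (H i)" for i a
      using Suc.prems(2) [of i] that by auto
    have d: "d m x \<in> carrier G" if "x \<in> A m" "m \<le> Suc k" for m x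
      unfolding d_def using that
      by (intro G.desc_prod_closed e) (auto simp: A_def PiE_iff)
    have finA: "finite (A m)" if "m \<le> Suc k" for m
      unfolding A_def carrier_product_group using that Suc.prems(1) by (intro finite_PiE) auto
    have d_Suc: "d (Suc k) (x(Suc k := a)) = e (Suc k) a \<otimes>\<^bsub>G\<^esub> d k x" for x a
      by (auto simp: d_def intro!: arg_cong2 [where f = "mult G"] desc_prod_cong)
    let ?P = "lin_ext (A k \<times> A k) (map_prod (d k) (d k)) (tensor_family k H J)"
    let ?L = "lin_ext (?C \<times> ?C) (map_prod (e (Suc k)) (e (Suc k))) (J (Suc k))"
    have "?L \<otimes>\<^bsub>group_algebra (G \<times>\<times> G)\<^esub> ?P =
        lin_ext (A (Suc k) \<times> A (Suc k)) (map_prod (d (Suc k)) (d (Suc k))) (tensor_family (Suc k) H J)"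
    proof (rule sq.group_algebra_eqI)
      show "lin_ext (A (Suc k) \<times> A (Suc k)) (map_prod (d (Suc k)) (d (Suc k))) (tensor_family (Suc k) H J)
          \<in> carrier (group_algebra (G \<times>\<times> G))"
        using d by (intro lin_ext_carrier) auto
      fix f
      have "pairing (carrier (G \<times>\<times> G)) (?L \<otimes>\<^bsub>group_algebra (G \<times>\<times> G)\<^esub> ?P) f =
          pairing (?C \<times> ?C) (J (Suc k)) (\<lambda>p. pairing (A k \<times> A k) (tensor_family k H J) (\<lambda>q.
            f (map_prod (e (Suc k)) (e (Suc k)) p \<otimes>\<^bsub>G \<times>\<times> G\<^esub> map_prod (d k) (d k) q)))"
        unfolding sq.pairing_mult
        using e d finA Suc.prems(1) by (subst (1 2) pairing_lin_ext) auto
      also have "\<dots> = pairing (?C \<times> ?C) (J (Suc k)) (\<lambda>(a, b).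
          pairing (A k \<times> A k) (tensor_family k H J) (\<lambda>(x, y).
            f (map_prod (d (Suc k)) (d (Suc k)) (x(Suc k := a), y(Suc k := b)))))"
        by (auto simp: d_Suc intro!: pairing_cong)
      also have "\<dots> = pairing (A (Suc k) \<times> A (Suc k)) (tensor_family (Suc k) H J)
          (\<lambda>p. f (map_prod (d (Suc k)) (d (Suc k)) p))"
        by (simp only: A_def carrier_product_group pairing_tensor_family_Suc)
      also have "\<dots> = pairing (carrier (G \<times>\<times> G)) (lin_ext (A (Suc k) \<times> A (Suc k))
          (map_prod (d (Suc k)) (d (Suc k))) (tensor_family (Suc k) H J)) f"
        using d finA by (subst pairing_lin_ext) auto
      finally show "pairing (carrier (G \<times>\<times> G)) (?L \<otimes>\<^bsub>group_algebra (G \<times>\<times> G)\<^esub> ?P) f =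
          pairing (carrier (G \<times>\<times> G)) (lin_ext (A (Suc k) \<times> A (Suc k))
          (map_prod (d (Suc k)) (d (Suc k))) (tensor_family (Suc k) H J)) f" .
    qed (rule sq.mult_carrier)
    moreover have "desc_prod (group_algebra (G \<times>\<times> G))
        (\<lambda>i. lin_ext (carrier (H i) \<times> carrier (H i)) (map_prod (e i) (e i)) (J i)) k = ?P"
      using Suc.prems by (intro Suc.IH) auto
    ultimately show ?case
      by simp
  qed
qed


section \<open>The embeddings of a hierarchy\<close>

context hierarchy
begin

lemma \<rho>_hom_H:
  assumes "i \<in> {2..n}" "g \<in> carrier (G (i - 1))"
  shows "\<rho> (i - 1) g \<in> hom (H i) (H i)"
  using hom_in_carrier [OF \<rho>_hom [OF assms(1)] assms(2)] by (simp add: AutoGroup_def auto_def)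

lemma \<rho>_one:
  assumes "i \<in> {2..n}" "h \<in> carrier (H i)"
  shows "\<rho> (i - 1) \<one>\<^bsub>G (i - 1)\<^esub> h = h"
proof -
  have "group (G (i - 1))" "group (H i)"
    using assms(1) by (auto intro!: group_G group_H)
  then have "\<rho> (i - 1) \<one>\<^bsub>G (i - 1)\<^esub> = \<one>\<^bsub>AutoGroup (H i)\<^esub>"
    using \<rho>_hom [OF assms(1)] by (intro hom_one group.AutoGroup)
  then show ?thesis
    using assms(2) by (simp add: AutoGroup_def BijGroup_def)
qed

lemma \<phi>_bij:
  assumes "i \<in> {2..n}"
  shows "bij_betw (\<phi> i) (carrier (G (i - 1)) \<times> carrier (H i)) (carrier (G i))"
  using \<phi>_iso [OF assms] by (simp add: iso_def semidirect_product_def)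

lemma \<phi>_closed:
  "i \<in> {2..n} \<Longrightarrow> g \<in> carrier (G (i - 1)) \<Longrightarrow> h \<in> carrier (H i) \<Longrightarrow> \<phi> i (g, h) \<in> carrier (G i)"
  using bij_betwE [OF \<phi>_bij] by auto

lemma \<phi>_mult:
  assumes "i \<in> {2..n}" "g \<in> carrier (G (i - 1))" "h \<in> carrier (H i)"
    "g' \<in> carrier (G (i - 1))" "h' \<in> carrier (H i)"
  shows "\<phi> i (g, h) \<otimes>\<^bsub>G i\<^esub> \<phi> i (g', h') =
         \<phi> i (g \<otimes>\<^bsub>G (i - 1)\<^esub> g', h \<otimes>\<^bsub>H i\<^esub> \<rho> (i - 1) g h')"
  using \<phi>_iso [OF assms(1)] assms(2-) by (auto simp: iso_def hom_def semidirect_product_def)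

text \<open>
  The two factors of \<open>G\<^sub>i = G\<^sub>i\<^sub>-\<^sub>1 \<ltimes> H\<^sub>i\<close> as subgroups: \<open>(g, h)\<close> is \<open>h g\<close>, and \<open>g h = \<rho> g h \<cdot> g\<close>.
\<close>

lemma
  assumes "i \<in> {2..n}"
  shows inl_hom: "(\<lambda>g. \<phi> i (g, \<one>\<^bsub>H i\<^esub>)) \<in> hom (G (i - 1)) (G i)"
    and inr_hom: "(\<lambda>h. \<phi> i (\<one>\<^bsub>G (i - 1)\<^esub>, h)) \<in> hom (H i) (G i)"
    and inr_inl: "g \<in> carrier (G (i - 1)) \<Longrightarrow> h \<in> carrier (H i) \<Longrightarrow>
      \<phi> i (\<one>\<^bsub>G (i - 1)\<^esub>, h) \<otimes>\<^bsub>G i\<^esub> \<phi> i (g, \<one>\<^bsub>H i\<^esub>) = \<phi> i (g, h)"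
    and inl_inr: "g \<in> carrier (G (i - 1)) \<Longrightarrow> h \<in> carrier (H i) \<Longrightarrow>
      \<phi> i (g, \<one>\<^bsub>H i\<^esub>) \<otimes>\<^bsub>G i\<^esub> \<phi> i (\<one>\<^bsub>G (i - 1)\<^esub>, h) = \<phi> i (g, \<rho> (i - 1) g h)"
proof -
  interpret K: group "G (i - 1)" using assms by (intro group_G) auto
  interpret N: group "H i" using assms by (intro group_H) auto
  have \<rho>_N: "\<rho> (i - 1) g h \<in> carrier (H i)" "\<rho> (i - 1) g \<one>\<^bsub>H i\<^esub> = \<one>\<^bsub>H i\<^esub>"
    if "g \<in> carrier (G (i - 1))" "h \<in> carrier (H i)" for g h
    using \<rho>_hom_H [OF assms that(1)] that(2) by (auto intro: hom_in_carrier hom_one N.is_group)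
  show "(\<lambda>g. \<phi> i (g, \<one>\<^bsub>H i\<^esub>)) \<in> hom (G (i - 1)) (G i)"
    using assms \<rho>_N(2) [OF _ N.one_closed] by (intro homI) (auto simp: \<phi>_mult \<phi>_closed simp del: One_nat_def)
  show "(\<lambda>h. \<phi> i (\<one>\<^bsub>G (i - 1)\<^esub>, h)) \<in> hom (H i) (G i)"
    using assms \<rho>_one [OF assms] by (intro homI) (auto simp: \<phi>_mult \<phi>_closed simp del: One_nat_def)
  show "\<phi> i (\<one>\<^bsub>G (i - 1)\<^esub>, h) \<otimes>\<^bsub>G i\<^esub> \<phi> i (g, \<one>\<^bsub>H i\<^esub>) = \<phi> i (g, h)"
    if "g \<in> carrier (G (i - 1))" "h \<in> carrier (H i)"
    using assms that \<rho>_one [OF assms] by (simp add: \<phi>_mult del: One_nat_def)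
  show "\<phi> i (g, \<one>\<^bsub>H i\<^esub>) \<otimes>\<^bsub>G i\<^esub> \<phi> i (\<one>\<^bsub>G (i - 1)\<^esub>, h) = \<phi> i (g, \<rho> (i - 1) g h)"
    if "g \<in> carrier (G (i - 1))" "h \<in> carrier (H i)"
    using assms that \<rho>_N by (simp add: \<phi>_mult del: One_nat_def)
qed

lemma emb_G_hom:
  assumes "1 \<le> i" "i + k \<le> n"
  shows "emb_G G H \<phi> i k \<in> hom (G i) (G (i + k))"
  using assms(2)
proof (induction k)
  case 0
  then show ?case by (simp add: hom_def)
next
  case (Suc k)
  then have "emb_G G H \<phi> i k \<in> hom (G i) (G (i + k))"
    and "(\<lambda>g. \<phi> (Suc (i + k)) (g, \<one>\<^bsub>H (Suc (i + k))\<^esub>)) \<in> hom (G (i + k)) (G (Suc (i + k)))"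
    using inl_hom [of "Suc (i + k)"] assms(1) by auto
  then show ?case
    using hom_compose by (fastforce simp: comp_def)
qed

lemma emb_H_self:
  assumes "i \<in> {2..n}"
  shows "emb_H G H \<phi> i i h = \<phi> i (\<one>\<^bsub>G (i - 1)\<^esub>, h)"
  using assms by (simp add: emb_H_def)

lemma emb_H_Suc:
  assumes "i \<le> m"
  shows "emb_H G H \<phi> (Suc m) i h = \<phi> (Suc m) (emb_H G H \<phi> m i h, \<one>\<^bsub>H (Suc m)\<^esub>)"
  using assms by (simp add: emb_H_def Suc_diff_le)

lemma emb_H_emb_G:
  assumes "j \<le> i" "i \<le> m"
  shows "emb_H G H \<phi> m j h = emb_G G H \<phi> i (m - i) (emb_H G H \<phi> i j h)"
  using assms(2)
proof (induction m rule: dec_induct)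
  case (step m)
  then show ?case
    using assms(1) by (simp add: emb_H_Suc Suc_diff_le)
qed simp

lemma emb_H_hom:
  assumes "i \<in> {1..m}" "m \<le> n"
  shows "emb_H G H \<phi> m i \<in> hom (H i) (G m)"
proof -
  have 1: "emb_H G H \<phi> i i \<in> hom (H i) (G i)"
  proof (cases "i = 1")
    case True
    then show ?thesis using G_1 by (simp add: emb_H_def hom_def)
  next
    case False
    then have i: "i \<in> {2..n}" using assms by auto
    then have "emb_H G H \<phi> i i = (\<lambda>h. \<phi> i (\<one>\<^bsub>G (i - 1)\<^esub>, h))"
      by (simp add: fun_eq_iff emb_H_self)
    then show ?thesis using inr_hom [OF i] by simp
  qed
  have 2: "emb_G G H \<phi> i (m - i) \<in> hom (G i) (G m)"
    using emb_G_hom [of i "m - i"] assms by simp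
  have 3: "emb_H G H \<phi> m i = emb_G G H \<phi> i (m - i) \<circ> emb_H G H \<phi> i i"
    using assms by (auto simp: emb_H_emb_G [of i i m])
  show ?thesis
    unfolding 3 using hom_compose [OF 1 2] .
qed

text \<open>
  The relation \<open>g h = \<rho> g h \<cdot> g\<close> holds in \<open>G\<^sub>i\<close>, where \<open>g \<in> H\<^sub>j \<subseteq> G\<^sub>i\<^sub>-\<^sub>1\<close>, and the embedding of \<open>G\<^sub>i\<close>
  carries it to \<open>G\<^sub>n\<close>.
\<close>

lemma emb_H_conj:
  assumes "1 \<le> j" "j < i" "i \<le> n" "g \<in> carrier (H j)" "h \<in> carrier (H i)"
  defines "r \<equiv> \<rho> (i - 1) (emb_H G H \<phi> (i - 1) j g)"
  shows "emb_H G H \<phi> n j g \<otimes>\<^bsub>G n\<^esub> emb_H G H \<phi> n i h =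
         emb_H G H \<phi> n i (r h) \<otimes>\<^bsub>G n\<^esub> emb_H G H \<phi> n j g"
proof -
  define g' where "g' = emb_H G H \<phi> (i - 1) j g"
  let ?e = "emb_G G H \<phi> i (n - i)"
  have i: "i \<in> {2..n}" using assms by auto
  have g': "g' \<in> carrier (G (i - 1))"
    unfolding g'_def by (rule hom_in_carrier [OF emb_H_hom]) (use assms in auto)
  have rh: "r h \<in> carrier (H i)"
    unfolding r_def using \<rho>_hom_H [OF i g'] assms(5) g'_def by (auto intro: hom_in_carrier)
  have e: "?e \<in> hom (G i) (G n)"
    using emb_G_hom [of i "n - i"] assms by simp
  have one: "\<one>\<^bsub>G (i - 1)\<^esub> \<in> carrier (G (i - 1))" "\<one>\<^bsub>H i\<^esub> \<in> carrier (H i)"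
    using i by (auto intro!: group.is_monoid group_G group_H monoid.one_closed)
  have j_eq: "emb_H G H \<phi> n j g = ?e (\<phi> i (g', \<one>\<^bsub>H i\<^esub>))"
    using assms emb_H_emb_G [of j i n g] emb_H_Suc [of j "i - 1" g] by (simp add: g'_def)
  have i_eq: "emb_H G H \<phi> n i x = ?e (\<phi> i (\<one>\<^bsub>G (i - 1)\<^esub>, x))" for x
    using assms emb_H_emb_G [of i i n x] emb_H_self [OF i] by simp
  have "\<phi> i (g', \<one>\<^bsub>H i\<^esub>) \<otimes>\<^bsub>G i\<^esub> \<phi> i (\<one>\<^bsub>G (i - 1)\<^esub>, h) =
      \<phi> i (\<one>\<^bsub>G (i - 1)\<^esub>, r h) \<otimes>\<^bsub>G i\<^esub> \<phi> i (g', \<one>\<^bsub>H i\<^esub>)"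
    using inl_inr [OF i g' assms(5)] inr_inl [OF i g' rh] by (simp add: r_def g'_def)
  then show ?thesis
    unfolding j_eq i_eq
    by (simp only: hom_mult [OF e, symmetric] \<phi>_closed i g' rh one assms(5))
qed

text \<open>
  Unique factorisation, by induction on \<open>m\<close>: in \<open>G\<^sub>m\<^sub>+\<^sub>1 = G\<^sub>m \<ltimes> H\<^sub>m\<^sub>+\<^sub>1\<close> the product
  \<open>x\<^sub>m\<^sub>+\<^sub>1 (x\<^sub>m \<cdots> x\<^sub>1)\<close> is the element named by the pair \<open>(x\<^sub>m \<cdots> x\<^sub>1, x\<^sub>m\<^sub>+\<^sub>1)\<close>.
\<close>

lemma bij_betw_desc_prod:
  assumes "1 \<le> m" "m \<le> n"
  shows "bij_betw (\<lambda>x. desc_prod (G m) (\<lambda>i. emb_H G H \<phi> m i (x i)) m)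
           (carrier (product_group {1..m} H)) (carrier (G m))"
  using assms
proof (induction m rule: nat_induct_at_least)
  case base
  interpret group "G 1" using length_pos by (intro group_G) auto
  have "desc_prod (G 1) (\<lambda>i. emb_H G H \<phi> 1 i (x i)) 1 = x 1"
    if "x \<in> (\<Pi>\<^sub>E i\<in>{1..1}. carrier (H i))" for x
  proof -
    have "x 1 \<in> carrier (G 1)"
      using PiE_mem [OF that, of 1] by (simp add: G_1 del: One_nat_def)
    then show ?thesis
      using r_one by (simp add: emb_H_def)
  qed
  then show ?case
    using bij_betw_PiE_1 [of "\<lambda>i. carrier (H i)"] unfolding carrier_product_group G_1 [symmetric]
    by (subst bij_betw_cong)
next
  case (Suc m)
  let ?d = "\<lambda>m x. desc_prod (G m) (\<lambda>i. emb_H G H \<phi> m i (x i)) m"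
  let ?A = "\<lambda>m. carrier (product_group {1..m} H)"
  have i: "Suc m \<in> {2..n}" using Suc by auto
  interpret K: group "G m" using Suc by (intro group_G) auto
  interpret M: group "G (Suc m)" using Suc by (intro group_G) auto
  have step: "?d (Suc m) (x(Suc m := a)) = \<phi> (Suc m) (?d m x, a)"
    if "a \<in> carrier (H (Suc m))" "x \<in> ?A m" for a x
  proof -
    have closed: "emb_H G H \<phi> m i (x i) \<in> carrier (G m)" if "i \<in> {1..m}" for i
      using \<open>x \<in> ?A m\<close> that Suc by (intro hom_in_carrier [OF emb_H_hom]) auto
    have "desc_prod (G (Suc m)) (\<lambda>i. emb_H G H \<phi> (Suc m) i ((x(Suc m := a)) i)) m =
        desc_prod (G (Suc m)) (\<lambda>i. \<phi> (Suc m) (emb_H G H \<phi> m i (x i), \<one>\<^bsub>H (Suc m)\<^esub>)) m"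
      by (rule desc_prod_cong) (auto simp: emb_H_Suc)
    also have "\<dots> = \<phi> (Suc m) (?d m x, \<one>\<^bsub>H (Suc m)\<^esub>)"
      using inl_hom [OF i] closed
      by (intro desc_prod_hom [symmetric, where h = "\<lambda>g. \<phi> (Suc m) (g, \<one>\<^bsub>H (Suc m)\<^esub>)"])
         (auto intro: K.is_monoid hom_one K.is_group M.is_group)
    finally have "?d (Suc m) (x(Suc m := a)) =
        \<phi> (Suc m) (\<one>\<^bsub>G m\<^esub>, a) \<otimes>\<^bsub>G (Suc m)\<^esub> \<phi> (Suc m) (?d m x, \<one>\<^bsub>H (Suc m)\<^esub>)"
      by (simp add: emb_H_self [OF i])
    moreover have "?d m x \<in> carrier (G m)"
      using closed by (rule K.desc_prod_closed)
    ultimately show ?thesis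
      using inr_inl [OF i, of "?d m x" a] that(1) by simp
  qed
  have "bij_betw (map_prod id (?d m)) (carrier (H (Suc m)) \<times> ?A m) (carrier (H (Suc m)) \<times> carrier (G m))"
    using Suc by (intro bij_betw_map_prod) auto
  moreover have "bij_betw prod.swap (carrier (H (Suc m)) \<times> carrier (G m)) (carrier (G m) \<times> carrier (H (Suc m)))"
    by (auto simp: bij_betw_def)
  moreover have "bij_betw (\<phi> (Suc m)) (carrier (G m) \<times> carrier (H (Suc m))) (carrier (G (Suc m)))"
    using \<phi>_bij [OF i] by simp
  ultimately have "bij_betw (\<phi> (Suc m) \<circ> (prod.swap \<circ> map_prod id (?d m)))
      (carrier (H (Suc m)) \<times> ?A m) (carrier (G (Suc m)))"
    by (meson bij_betw_trans)
  then have "bij_betw (?d (Suc m) \<circ> (\<lambda>(a, x). x(Suc m := a)))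
      (carrier (H (Suc m)) \<times> ?A m) (carrier (G (Suc m)))"
    by (rule bij_betw_cong [THEN iffD1, rotated]) (auto simp only: step o_apply map_prod_simp swap_simp id_apply split_conv)
  then show ?case
    unfolding carrier_product_group
    by (rule bij_betw_comp_iff [OF bij_betw_PiE_Suc, THEN iffD2])
qed

lemma inv_hierarchy_pi:
  assumes "x \<in> carrier (product_group {1..n} H)"
  shows "inv_into (carrier (G n)) (hierarchy_pi n G H \<phi>) x =
         desc_prod (G n) (\<lambda>i. emb_H G H \<phi> n i (x i)) n"
proof -
  let ?d = "\<lambda>x. desc_prod (G n) (\<lambda>i. emb_H G H \<phi> n i (x i)) n"
  let ?A = "carrier (product_group {1..n} H)"
  have bij: "bij_betw ?d ?A (carrier (G n))"
    using length_pos by (intro bij_betw_desc_prod) auto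
  have pi: "hierarchy_pi n G H \<phi> (?d y) = y" if "y \<in> ?A" for y
    unfolding hierarchy_pi_def
    by (rule the_equality) (use that bij in \<open>auto simp: bij_betw_def inj_on_def\<close>)
  have "inj_on (hierarchy_pi n G H \<phi>) (carrier (G n))"
    unfolding bij_betw_imp_surj_on [OF bij, symmetric]
    by (auto simp: inj_on_def pi simp del: carrier_product_group)
  moreover have "?d x \<in> carrier (G n)"
    using bij_betwE [OF bij] assms by blast
  ultimately have "inv_into (carrier (G n)) (hierarchy_pi n G H \<phi>) (hierarchy_pi n G H \<phi> (?d x)) = ?d x"
    by (rule inv_into_f_f)
  then show ?thesis
    unfolding pi [OF assms] .
qed

end


section \<open>The twist of a hierarchy\<close>

context twist_hierarchy
begin

text \<open>
  This is where the invariance of \<open>J\<^sub>i\<close> is used: moving \<open>k \<otimes> k\<close> across \<open>L\<^sub>i\<close> applies \<open>\<rho>\<close> to both tensor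
  factors of \<open>J\<^sub>i\<close>.
\<close>

lemma emb_H_in_centralizer:
  assumes "1 \<le> j" "j < i" "i \<le> n" "g \<in> carrier (H j)"
  defines "k \<equiv> emb_H G H \<phi> n j g"
  shows "(k, k) \<in> centralizer (G n \<times>\<times> G n)
    (lin_ext (carrier (H i) \<times> carrier (H i)) (map_prod (emb_H G H \<phi> n i) (emb_H G H \<phi> n i)) (J i))"
proof -
  define r where "r = \<rho> (i - 1) (emb_H G H \<phi> (i - 1) j g)"
  let ?e = "emb_H G H \<phi> n i"
  let ?X = "carrier (H i) \<times> carrier (H i)"
  let ?m = "mult (G n \<times>\<times> G n)"
  have i: "i \<in> {2..n}" using assms by auto
  have g': "emb_H G H \<phi> (i - 1) j g \<in> carrier (G (i - 1))"
    by (rule hom_in_carrier [OF emb_H_hom]) (use assms in auto)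
  have r: "r h \<in> carrier (H i)" if "h \<in> carrier (H i)" for h
    using hom_in_carrier [OF \<rho>_hom_H [OF i g'] that] by (simp add: r_def)
  have e: "?e h \<in> carrier (G n)" if "h \<in> carrier (H i)" for h
    using emb_H_hom [of i n] i that by (auto intro: hom_in_carrier)
  have k: "k \<in> carrier (G n)"
    unfolding k_def by (rule hom_in_carrier [OF emb_H_hom]) (use assms in auto)
  have fin: "finite (carrier (H i))" "finite (carrier (G n))"
    using i by (auto intro!: finite_H finite_G)
  have "pairing (carrier (G n \<times>\<times> G n)) (lin_ext ?X (map_prod ?e ?e) (J i)) (\<lambda>p. f (?m (k, k) p)) =
        pairing (carrier (G n \<times>\<times> G n)) (lin_ext ?X (map_prod ?e ?e) (J i)) (\<lambda>p. f (?m p (k, k)))" for f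
  proof -
    have "pairing (carrier (G n \<times>\<times> G n)) (lin_ext ?X (map_prod ?e ?e) (J i)) (\<lambda>p. f (?m (k, k) p)) =
        pairing ?X (J i) (\<lambda>p. f (?m (k, k) (map_prod ?e ?e p)))"
      using fin e by (subst pairing_lin_ext) auto
    also have "\<dots> = pairing ?X (J i) (\<lambda>p. f (?m (map_prod ?e ?e (map_prod r r p)) (k, k)))"
      using assms(1-4) by (auto simp: k_def r_def emb_H_conj intro!: pairing_cong)
    also have "\<dots> = pairing ?X (lin_ext ?X (map_prod r r) (J i)) (\<lambda>p. f (?m (map_prod ?e ?e p) (k, k)))"
      using fin r by (subst pairing_lin_ext) auto
    also have "lin_ext ?X (map_prod r r) (J i) = J i"
      unfolding r_def by (rule invariant_J [OF i g'])
    also have "pairing ?X (J i) (\<lambda>p. f (?m (map_prod ?e ?e p) (k, k))) =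
        pairing (carrier (G n \<times>\<times> G n)) (lin_ext ?X (map_prod ?e ?e) (J i)) (\<lambda>p. f (?m p (k, k)))"
      using fin e by (subst pairing_lin_ext) auto
    finally show ?thesis .
  qed
  then show ?thesis
    using k by (simp add: centralizer_def)
qed

text \<open>
  The partial products \<open>L\<^sub>k \<cdots> L\<^sub>1\<close>. The second part, on which the next step of the induction
  relies, says that their support consists of elements of \<open>G\<^sub>k\<close> and so commutes diagonally with
  all the later \<open>L\<^sub>i\<close>; centralizers are closed under products, so it is inherited factor by factor.
\<close>

lemma is_twist_desc_prod:
  assumes "k \<le> n"
  defines "L \<equiv> \<lambda>i. lin_ext (carrier (H i) \<times> carrier (H i))
             (map_prod (emb_H G H \<phi> n i) (emb_H G H \<phi> n i)) (J i)"
  defines "P \<equiv> desc_prod (group_algebra (G n \<times>\<times> G n)) L"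
  shows "is_twist (G n) (P k)"
    and "\<And>a b i. P k (a, b) \<noteq> 0 \<Longrightarrow> k < i \<Longrightarrow> i \<le> n \<Longrightarrow>
      (a, a) \<in> centralizer (G n \<times>\<times> G n) (L i) \<and> (b, b) \<in> centralizer (G n \<times>\<times> G n) (L i)"
proof -
  interpret Gn: group "G n" using length_pos by (intro group_G) auto
  have fin: "finite_monoid (G n)"
    using length_pos by (intro finite_monoid_group group_G finite_G) auto
  interpret Gn: finite_monoid "G n" by (rule fin)
  interpret sq: finite_monoid "G n \<times>\<times> G n" by (rule Gn.finite_monoid_square)
  have "is_twist (G n) (P k) \<and> (\<forall>a b i. P k (a, b) \<noteq> 0 \<longrightarrow> k < i \<longrightarrow> i \<le> n \<longrightarrow>
      (a, a) \<in> centralizer (G n \<times>\<times> G n) (L i) \<and> (b, b) \<in> centralizer (G n \<times>\<times> G n) (L i))"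
    using assms(1)
  proof (induction k)
    case 0
    have "P 0 = \<one>\<^bsub>group_algebra (G n \<times>\<times> G n)\<^esub>"
      by (simp add: P_def)
    moreover have "a = \<one>\<^bsub>G n\<^esub> \<and> b = \<one>\<^bsub>G n\<^esub>" if "P 0 (a, b) \<noteq> 0" for a b
      using that by (auto simp: P_def group_algebra_def split: if_splits)
    ultimately show ?case
      using sq.centralizer_one Gn.is_twist_one by (metis one_DirProd)
  next
    case (Suc k)
    let ?i = "Suc k"
    have P_Suc: "P (Suc k) = L (Suc k) \<otimes>\<^bsub>group_algebra (G n \<times>\<times> G n)\<^esub> P k"
      by (simp add: P_def)
    have i: "Suc k \<in> {1..n}" using Suc.prems by auto
    have gH: "group (H (Suc k))" and fH: "finite_monoid (H (Suc k))"
      using i by (auto intro!: finite_monoid_group group_H finite_H)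
    have hom: "emb_H G H \<phi> n (Suc k) \<in> hom (H (Suc k)) (G n)"
      using i by (intro emb_H_hom) auto
    have "is_twist (G n) (L (Suc k))"
      unfolding L_def
      by (rule is_twist_lin_ext [OF fH fin hom hom_one [OF hom gH Gn.is_group] twist_J [OF i]])
    moreover have "is_twist (G n) (P k)"
      using Suc by auto
    ultimately have "is_twist (G n) (P (Suc k))"
      unfolding P_Suc by (rule Gn.is_twist_mult) (use Suc in auto)
    moreover have "(a, a) \<in> centralizer (G n \<times>\<times> G n) (L l) \<and> (b, b) \<in> centralizer (G n \<times>\<times> G n) (L l)"
      if nz: "P (Suc k) (a, b) \<noteq> 0" and l: "Suc k < l" "l \<le> n" for a b l
    proof -
      obtain a1 b1 a2 b2 where ab: "a = a1 \<otimes>\<^bsub>G n\<^esub> a2" "b = b1 \<otimes>\<^bsub>G n\<^esub> b2"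
        and 1: "L (Suc k) (a1, b1) \<noteq> 0" and 2: "P k (a2, b2) \<noteq> 0"
        using nz unfolding P_Suc by (auto elim!: sq.mult_support)
      from 1 obtain g h where "g \<in> carrier (H (Suc k))" "h \<in> carrier (H (Suc k))"
        "a1 = emb_H G H \<phi> n (Suc k) g" "b1 = emb_H G H \<phi> n (Suc k) h"
        unfolding L_def by (auto elim!: lin_ext_support)
      with l have "(a1, a1) \<in> centralizer (G n \<times>\<times> G n) (L l)" "(b1, b1) \<in> centralizer (G n \<times>\<times> G n) (L l)"
        unfolding L_def by (auto intro!: emb_H_in_centralizer)
      moreover have "(a2, a2) \<in> centralizer (G n \<times>\<times> G n) (L l) \<and> (b2, b2) \<in> centralizer (G n \<times>\<times> G n) (L l)"
        using Suc 2 l by auto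
      ultimately show ?thesis
        unfolding ab using sq.centralizer_mult by (metis mult_DirProd)
    qed
    ultimately show ?case by blast
  qed
  then show "is_twist (G n) (P k)"
    and "\<And>a b i. P k (a, b) \<noteq> 0 \<Longrightarrow> k < i \<Longrightarrow> i \<le> n \<Longrightarrow>
      (a, a) \<in> centralizer (G n \<times>\<times> G n) (L i) \<and> (b, b) \<in> centralizer (G n \<times>\<times> G n) (L i)"
    by blast+
qed

end

theorem proposition2p4:
  fixes n :: nat
    and G H :: "nat \<Rightarrow> 'g monoid"
    and \<rho> :: "nat \<Rightarrow> 'g \<Rightarrow> 'g \<Rightarrow> 'g"
    and \<phi> :: "nat \<Rightarrow> 'g \<times> 'g \<Rightarrow> 'g"
    and J :: "nat \<Rightarrow> 'g \<times> 'g \<Rightarrow> complex"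
    and A :: "(nat \<Rightarrow> 'g) monoid"
    and \<pi> :: "'g \<Rightarrow> nat \<Rightarrow> 'g"
    and \<pi>_inv :: "(nat \<Rightarrow> 'g) \<Rightarrow> 'g"
    and Jbar :: "'g \<times> 'g \<Rightarrow> complex"
  assumes "twist_hierarchy n G H \<rho> \<phi> J"
  defines "A \<equiv> product_group {1..n} H"
    and "\<pi> \<equiv> hierarchy_pi n G H \<phi>"
    and "\<pi>_inv \<equiv> inv_into (carrier (G n)) \<pi>"
    and "Jbar \<equiv> lin_ext (carrier A \<times> carrier A) (map_prod \<pi>_inv \<pi>_inv) (tensor_family n H J)"
  shows "Jbar = desc_prod (group_algebra (G n \<times>\<times> G n))
           (\<lambda>i. lin_ext (carrier (H i) \<times> carrier (H i))
                  (map_prod (emb_H G H \<phi> n i) (emb_H G H \<phi> n i)) (J i)) n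
         \<and> is_twist (G n) Jbar"
proof -
  interpret twist_hierarchy n G H \<rho> \<phi> J by fact
  let ?d = "\<lambda>x. desc_prod (G n) (\<lambda>i. emb_H G H \<phi> n i (x i)) n"
  let ?L = "\<lambda>i. lin_ext (carrier (H i) \<times> carrier (H i))
                  (map_prod (emb_H G H \<phi> n i) (emb_H G H \<phi> n i)) (J i)"
  have fin: "finite_monoid (G n)"
    using length_pos by (intro finite_monoid_group group_G finite_G) auto
  have "Jbar = lin_ext (carrier A \<times> carrier A) (map_prod ?d ?d) (tensor_family n H J)"
    unfolding Jbar_def
    by (rule lin_ext_cong) (auto simp: \<pi>_inv_def \<pi>_def A_def inv_hierarchy_pi simp del: carrier_product_group)
  also have "\<dots> = desc_prod (group_algebra (G n \<times>\<times> G n)) ?L n"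
    unfolding A_def
  proof (rule desc_prod_lin_ext [OF fin, symmetric])
    show "emb_H G H \<phi> n i ` carrier (H i) \<subseteq> carrier (G n)" if "i \<in> {1..n}" for i
      using emb_H_hom [of i n] that by (intro hom_carrier) auto
  qed (rule finite_H)
  finally have "Jbar = desc_prod (group_algebra (G n \<times>\<times> G n)) ?L n" .
  then show ?thesis
    using is_twist_desc_prod(1) [of n] by simp
qed

end
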